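(* Let $n\ge1$, $C,D\in\mathbb{R}$, and let $L=\sum_{x=0}^{2^n-1}(C+Dx)\,|x\rangle\langle x|$ be a diagonal $2^n\times2^n$ matrix whose entries form an arithmetic progression. Let $L=\sum_{P}\alpha_PP$ be its expansion in $n$-qubit Pauli strings $P\in\{I,X,Y,Z\}^{\otimes n}$. Then the Pauli terms with $\alpha_P\neq0$ in this decomposition commute pairwise, and hence the single-step (first-order, one Trotter step) product formula is exact: for every $\theta\in\mathbb{R}$, $$e^{-i\theta L}=\prod_{P:\,\alpha_P\ne0}e^{-i\theta\alpha_PP}.$$
   Context: $I,X,Y,Z$ are the $2\times2$ identity and Pauli matrices, and $\alpha_P=2^{-n}\operatorname{Tr}(PL)$. The basis vector $|x\rangle$ is the computational basis vector of $(\mathbb{C}^2)^{\otimes n}$, $|x\rangle=|x_1\rangle\otimes\cdots\otimes|x_n\rangle$ with $x=\sum_{j=1}^n2^{j-1}x_j$. *)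

theory Defs
  imports Complex_Main "Jordan_Normal_Form.Matrix"
begin

datatype pauli = PI | PX | PY | PZ

fun pauli_mat :: "pauli \<Rightarrow> complex mat" where
  "pauli_mat PI = mat_of_rows_list 2 [[1, 0], [0, 1]]"
| "pauli_mat PX = mat_of_rows_list 2 [[0, 1], [1, 0]]"
| "pauli_mat PY = mat_of_rows_list 2 [[0, - \<i>], [\<i>, 0]]"
| "pauli_mat PZ = mat_of_rows_list 2 [[1, 0], [0, - 1]]"

(* Coordinates of the n-fold tensor power of C^2 follow the convention that the first tensor
   factor is the least significant bit: list position j (counted from 0) is the (j+1)-st tensor
   factor and carries the binary digit of weight 2^j. *)

definition qbit :: "nat \<Rightarrow> nat \<Rightarrow> nat" where
  "qbit x j = x div 2 ^ j mod 2"

definition tensor_vec :: "complex vec list \<Rightarrow> complex vec" where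
  "tensor_vec vs = vec (2 ^ length vs) (\<lambda>x. \<Prod>j<length vs. (vs ! j) $ qbit x j)"

definition tensor_mat :: "complex mat list \<Rightarrow> complex mat" where
  "tensor_mat As = mat (2 ^ length As) (2 ^ length As)
     (\<lambda>(x, y). \<Prod>j<length As. (As ! j) $$ (qbit x j, qbit y j))"

definition ket :: "nat \<Rightarrow> nat \<Rightarrow> complex vec" where
  "ket n x = tensor_vec (map (\<lambda>j. unit_vec 2 (qbit x j)) [0..<n])"

definition ketbra :: "complex vec \<Rightarrow> complex vec \<Rightarrow> complex mat" where
  "ketbra v w = mat (dim_vec v) (dim_vec w) (\<lambda>(i, j). v $ i * cnj (w $ j))"

(* The type of matrices of variable size is not an additive monoid, so the big-sum notation
   does not apply to it directly. *)
definition mat_sum :: "nat \<Rightarrow> ('a \<Rightarrow> complex mat) \<Rightarrow> 'a set \<Rightarrow> complex mat" where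
  "mat_sum N f S = mat N N (\<lambda>(i, j). \<Sum>a\<in>S. f a $$ (i, j))"

definition mat_prod_list :: "nat \<Rightarrow> complex mat list \<Rightarrow> complex mat" where
  "mat_prod_list N As = foldr (*) As (1\<^sub>m N)"

definition mat_trace :: "complex mat \<Rightarrow> complex" where
  "mat_trace A = sum_list (diag_mat A)"

(* The power series of the exponential, summed entrywise; for square A it converges by
   mat_exp_summable below. *)
definition mat_exp :: "complex mat \<Rightarrow> complex mat" where
  "mat_exp A = mat (dim_row A) (dim_row A) (\<lambda>(i, j). \<Sum>k. (A ^\<^sub>m k) $$ (i, j) / fact k)"

definition arith_diag :: "nat \<Rightarrow> real \<Rightarrow> real \<Rightarrow> complex mat" where
  "arith_diag n C D =
     mat_sum (2 ^ n) (\<lambda>x. complex_of_real (C + D * real x) \<cdot>\<^sub>m ketbra (ket n x) (ket n x)) {..<2 ^ n}"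

definition pauli_strings :: "nat \<Rightarrow> pauli list set" where
  "pauli_strings n = {P. length P = n}"

definition pauli_string_mat :: "pauli list \<Rightarrow> complex mat" where
  "pauli_string_mat P = tensor_mat (map pauli_mat P)"

definition pauli_coeff :: "nat \<Rightarrow> complex mat \<Rightarrow> pauli list \<Rightarrow> complex" where
  "pauli_coeff n L P = mat_trace (pauli_string_mat P * L) / 2 ^ n"

definition pauli_support :: "nat \<Rightarrow> complex mat \<Rightarrow> pauli list set" where
  "pauli_support n L = {P \<in> pauli_strings n. pauli_coeff n L P \<noteq> 0}"

lemma qbit_lt_2 [simp]: "qbit x j < 2"
  by (simp add: qbit_def)

lemma qbit_ext:
  assumes "x < 2 ^ n" "y < 2 ^ n" "\<And>j. j < n \<Longrightarrow> qbit x j = qbit y j"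
  shows "x = y"
proof (rule bit_eqI)
  fix j
  show "bit x j = bit y j"
  proof (cases "j < n")
    case True
    then show ?thesis
      unfolding bit_iff_odd using assms(3)[of j] by (metis qbit_def even_iff_mod_2_eq_zero)
  next
    case False
    then have "(2::nat) ^ n \<le> 2 ^ j" by simp
    then have "x < 2 ^ j" "y < 2 ^ j" using assms(1,2) by linarith+
    then show ?thesis by (simp add: bit_iff_odd)
  qed
qed

lemma ket_eq_unit_vec:
  assumes "x < 2 ^ n"
  shows "ket n x = unit_vec (2 ^ n) x"
proof (rule eq_vecI)
  fix y assume "y < dim_vec (unit_vec (2 ^ n) x :: complex vec)"
  then have y: "y < 2 ^ n" by simp
  have "ket n x $ y = (\<Prod>j<n. if qbit y j = qbit x j then 1 else 0)"
    using y by (simp add: ket_def tensor_vec_def)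
  also have "\<dots> = (if y = x then 1 else 0)"
    using qbit_ext[OF y assms] by auto
  finally show "ket n x $ y = unit_vec (2 ^ n) x $ y" using y assms by simp
qed (simp add: ket_def tensor_vec_def)

lemma arith_diag_eq_mat_diag:
  "arith_diag n C D = mat_diag (2 ^ n) (\<lambda>x. complex_of_real (C + D * real x))"
proof (rule eq_matI)
  fix i j assume "i < dim_row (mat_diag (2 ^ n) (\<lambda>x. complex_of_real (C + D * real x)))"
    "j < dim_col (mat_diag (2 ^ n) (\<lambda>x. complex_of_real (C + D * real x)))"
  then have ij: "i < 2 ^ n" "j < 2 ^ n" by (simp_all add: mat_diag_def)
  have entry: "(complex_of_real (C + D * real x) \<cdot>\<^sub>m ketbra (ket n x) (ket n x)) $$ (i, j) =
      (if x = i then (if i = j then complex_of_real (C + D * real i) else 0) else 0)"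
    if "x < 2 ^ n" for x
    unfolding ket_eq_unit_vec[OF that] ketbra_def using ij that by simp
  have "arith_diag n C D $$ (i, j) =
    (\<Sum>x<2 ^ n. if x = i then (if i = j then complex_of_real (C + D * real i) else 0) else 0)"
    unfolding arith_diag_def mat_sum_def using ij entry by (simp del: of_real_add of_real_mult)
  also have "\<dots> = (if i = j then complex_of_real (C + D * real i) else 0)"
    using ij by simp
  finally show "arith_diag n C D $$ (i, j) = mat_diag (2 ^ n) (\<lambda>x. complex_of_real (C + D * real x)) $$ (i, j)"
    using ij by (simp add: mat_diag_def)
qed (simp_all add: arith_diag_def mat_sum_def mat_diag_def)

lemma mat_exp_summable:
  fixes A :: "complex mat"
  assumes A: "A \<in> carrier_mat N N" and ij: "i < N" "j < N"
  shows "summable (\<lambda>k. (A ^\<^sub>m k) $$ (i, j) / fact k)"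
proof -
  define M where "M = (\<Sum>i<N. \<Sum>j<N. cmod (A $$ (i, j)))"
  have M0: "M \<ge> 0" unfolding M_def by (intro sum_nonneg) auto
  have bnd: "(\<Sum>l<N. cmod ((A ^\<^sub>m k) $$ (i, l))) \<le> M ^ k" if "i < N" for i k
  proof (induction k)
    case 0
    have "(\<Sum>l<N. cmod ((A ^\<^sub>m 0) $$ (i, l))) = (\<Sum>l<N. if l = i then 1 else 0)"
      using A that by (intro sum.cong) auto
    then show ?case using that by simp
  next
    case (Suc k)
    have P: "A ^\<^sub>m k \<in> carrier_mat N N" using A by simp
    have "(\<Sum>l<N. cmod ((A ^\<^sub>m Suc k) $$ (i, l)))
        \<le> (\<Sum>l<N. \<Sum>m<N. cmod ((A ^\<^sub>m k) $$ (i, m)) * cmod (A $$ (m, l)))"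
      using A P that
      by (intro sum_mono)
        (auto simp: scalar_prod_def atLeast0LessThan norm_mult intro!: order.trans[OF norm_sum])
    also have "\<dots> = (\<Sum>m<N. cmod ((A ^\<^sub>m k) $$ (i, m)) * (\<Sum>l<N. cmod (A $$ (m, l))))"
      by (subst sum.swap) (simp add: sum_distrib_left)
    also have "\<dots> \<le> (\<Sum>m<N. cmod ((A ^\<^sub>m k) $$ (i, m)) * M)"
    proof (intro sum_mono mult_left_mono)
      fix m assume "m \<in> {..<N}"
      then show "(\<Sum>l<N. cmod (A $$ (m, l))) \<le> M"
        unfolding M_def by (intro member_le_sum) (auto intro: sum_nonneg)
    qed auto
    also have "\<dots> \<le> M ^ k * M"
      using Suc M0 by (simp add: sum_distrib_right[symmetric] mult_right_mono)
    finally show ?case by (simp add: mult.commute)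
  qed
  have "summable (\<lambda>k. M ^ k / fact k)"
    using summable_exp[of M] by (simp add: divide_inverse mult.commute)
  then show ?thesis
  proof (rule summable_comparison_test'[where N = 0])
    fix k
    have "cmod ((A ^\<^sub>m k) $$ (i, j)) \<le> (\<Sum>l<N. cmod ((A ^\<^sub>m k) $$ (i, l)))"
      using ij by (intro member_le_sum) auto
    also have "\<dots> \<le> M ^ k" by (rule bnd[OF ij(1)])
    finally show "cmod ((A ^\<^sub>m k) $$ (i, j) / fact k) \<le> M ^ k / fact k"
      by (simp add: norm_divide divide_right_mono)
  qed
qed

end

theory Submission
  imports Defs
begin

text \<open>
  The Pauli expansion is the \<open>n\<close>-fold product of the one-qubit completeness relation
  \<open>(\<Sum>\<sigma>. \<sigma>\<^sub>a\<^sub>b \<sigma>\<^sub>c\<^sub>d) = 2 \<delta>\<^sub>a\<^sub>d \<delta>\<^sub>b\<^sub>c\<close>. A string containing \<open>X\<close> or \<open>Y\<close> has zero diagonal, so its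
  trace against a diagonal matrix vanishes; hence only strings over \<open>I, Z\<close> occur in the expansion of
  a diagonal matrix. These are themselves diagonal, so everything reduces to
  \<open>exp (\<Sum>\<^sub>P z\<^sub>P) = (\<Prod>\<^sub>P exp z\<^sub>P)\<close> in each diagonal entry.
\<close>

lemma dim_mat_diag [simp]: "dim_row (mat_diag n f) = n" "dim_col (mat_diag n f) = n"
  by (simp_all add: mat_diag_def)

lemma index_mat_diag [simp]:
  "i < n \<Longrightarrow> j < n \<Longrightarrow> mat_diag n f $$ (i, j) = (if i = j then f j else 0)"
  by (simp add: mat_diag_def)

text \<open>This and the next three lemmas turn a matrix identity between diagonal matrices into one
  scalar identity per diagonal entry.\<close>

lemma smult_mat_diag: "c \<cdot>\<^sub>m mat_diag n f = mat_diag n (\<lambda>i. (c :: 'a :: semiring_1) * f i)"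
  by (rule eq_matI) auto

lemma mat_diag_pow: "mat_diag n f ^\<^sub>m k = mat_diag n (\<lambda>i. (f i :: 'a :: comm_semiring_1) ^ k)"
  by (induction k) (simp_all add: mult.commute)

text \<open>Every power, the zeroth included, is diagonal, so each off-diagonal series is
  identically zero and each diagonal one is the scalar exponential series.\<close>

lemma mat_exp_mat_diag: "mat_exp (mat_diag n f) = mat_diag n (\<lambda>i. exp (f i))"
  by (rule eq_matI)
    (auto simp: mat_exp_def mat_diag_pow exp_def scaleR_conv_of_real divide_inverse mult.commute)

lemma mat_prod_list_mat_diag:
  "mat_prod_list n (map (\<lambda>a. mat_diag n (f a)) as) = mat_diag n (\<lambda>i. \<Prod>a\<leftarrow>as. f a i)"
  by (induction as) (simp_all add: mat_prod_list_def)

lemma mat_trace_mult: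
  assumes "A \<in> carrier_mat N N" "B \<in> carrier_mat N N"
  shows "mat_trace (A * B) = (\<Sum>u<N. \<Sum>v<N. A $$ (u, v) * B $$ (v, u))"
  using assms
  by (simp add: mat_trace_def diag_mat_def interv_sum_list_conv_sum_set_nat scalar_prod_def
      atLeast0LessThan)

lemma UNIV_pauli: "UNIV = {PI, PX, PY, PZ}"
  using pauli.exhaust by blast

instance pauli :: finite
  by standard (simp add: UNIV_pauli)

lemma pauli_strings_Suc: "pauli_strings (Suc n) = (\<lambda>(p, P). p # P) ` (UNIV \<times> pauli_strings n)"
  by (auto simp: pauli_strings_def length_Suc_conv image_iff)

lemma finite_pauli_strings: "finite (pauli_strings n)"
  using finite_lists_length_eq[of "UNIV :: pauli set" n] by (simp add: pauli_strings_def)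

text \<open>Distributivity: expanding the product of sums picks one summand per position, that is,
  one Pauli string. \<open>f\<close> depends on the position and is generalised because removing the
  head of a string shifts the remaining positions by one.\<close>

lemma sum_pauli_strings_prod:
  fixes f :: "nat \<Rightarrow> pauli \<Rightarrow> 'a :: comm_semiring_1"
  shows "(\<Sum>P\<in>pauli_strings n. \<Prod>j<n. f j (P ! j)) = (\<Prod>j<n. \<Sum>p\<in>UNIV. f j p)"
proof (induction n arbitrary: f)
  case 0
  then show ?case by (simp add: pauli_strings_def)
next
  case (Suc n)
  have "inj_on (\<lambda>(p, P). p # P) (UNIV \<times> pauli_strings n)"
    by (auto simp: inj_on_def)
  then have "(\<Sum>P\<in>pauli_strings (Suc n). \<Prod>j<Suc n. f j (P ! j))
      = (\<Sum>p\<in>UNIV. \<Sum>P\<in>pauli_strings n. f 0 p * (\<Prod>j<n. f (Suc j) (P ! j)))"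
    by (simp add: pauli_strings_Suc sum.reindex sum.cartesian_product prod.lessThan_Suc_shift
        case_prod_unfold del: prod.lessThan_Suc)
  also have "\<dots> = (\<Sum>p\<in>UNIV. f 0 p) * (\<Prod>j<n. \<Sum>p\<in>UNIV. f (Suc j) p)"
    by (simp add: sum_distrib_left[symmetric] sum_distrib_right[symmetric]
        Suc.IH[of "\<lambda>j. f (Suc j)"])
  finally show ?case by (simp add: prod.lessThan_Suc_shift del: prod.lessThan_Suc)
qed

text \<open>The sum of the tensor squares of the Pauli matrices is twice the swap of two qubits; the
  proof checks all 16 index combinations.\<close>

lemma pauli_mat_completeness:
  assumes "a < 2" "b < 2" "c < 2" "d < 2"
  shows "(\<Sum>p\<in>UNIV. pauli_mat p $$ (a, b) * pauli_mat p $$ (c, d)) =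
    (if a = d \<and> b = c then 2 else 0)"
proof -
  have "a \<in> {0, 1}" "b \<in> {0, 1}" "c \<in> {0, 1}" "d \<in> {0, 1}"
    using assms by auto
  then show ?thesis
    by (auto simp: UNIV_pauli mat_of_rows_list_def)
qed

lemma pauli_string_mat_carrier:
  "P \<in> pauli_strings n \<Longrightarrow> pauli_string_mat P \<in> carrier_mat (2 ^ n) (2 ^ n)"
  by (simp add: pauli_strings_def pauli_string_mat_def tensor_mat_def)

lemma pauli_string_mat_index:
  assumes "P \<in> pauli_strings n" "x < 2 ^ n" "y < 2 ^ n"
  shows "pauli_string_mat P $$ (x, y) = (\<Prod>j<n. pauli_mat (P ! j) $$ (qbit x j, qbit y j))"
  using assms by (simp add: pauli_strings_def pauli_string_mat_def tensor_mat_def)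

text \<open>The sum factorises over the tensor positions. Each position contributes 2 or 0, and the
  product survives only if all binary digits match, which by \<open>qbit_ext\<close> means equality
  of the indices.\<close>

lemma pauli_string_completeness:
  assumes "u < 2 ^ n" "v < 2 ^ n" "x < 2 ^ n" "y < 2 ^ n"
  shows "(\<Sum>P\<in>pauli_strings n. pauli_string_mat P $$ (u, v) * pauli_string_mat P $$ (x, y)) =
    (if u = y \<and> v = x then 2 ^ n else 0)"
proof -
  have "(\<Sum>P\<in>pauli_strings n. pauli_string_mat P $$ (u, v) * pauli_string_mat P $$ (x, y)) =
      (\<Prod>j<n. if qbit u j = qbit y j \<and> qbit v j = qbit x j then 2 else 0)"
    using assms
    by (simp add: pauli_string_mat_index prod.distrib[symmetric] pauli_mat_completeness
        sum_pauli_strings_prod[where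
          f = "\<lambda>j p. pauli_mat p $$ (qbit u j, qbit v j) * pauli_mat p $$ (qbit x j, qbit y j)"])
  also have "\<dots> = (if u = y \<and> v = x then 2 ^ n else 0)"
    using qbit_ext[OF assms(1,4)] qbit_ext[OF assms(2,3)] by auto
  finally show ?thesis .
qed

text \<open>Once the traces are written out entrywise, completeness selects the single term
  \<open>u = y\<close>, \<open>v = x\<close>, and its factor \<open>2 ^ n\<close> cancels the
  normalisation of \<open>pauli_coeff\<close>.\<close>

lemma pauli_expansion:
  assumes A: "A \<in> carrier_mat (2 ^ n) (2 ^ n)"
  shows "A = mat_sum (2 ^ n) (\<lambda>P. pauli_coeff n A P \<cdot>\<^sub>m pauli_string_mat P) (pauli_strings n)"
proof (rule eq_matI)
  let ?S = "mat_sum (2 ^ n) (\<lambda>P. pauli_coeff n A P \<cdot>\<^sub>m pauli_string_mat P) (pauli_strings n)"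
  fix x y assume "x < dim_row ?S" "y < dim_col ?S"
  then have xy: "x < 2 ^ n" "y < 2 ^ n" by (simp_all add: mat_sum_def)
  have "?S $$ (x, y) =
      (\<Sum>P\<in>pauli_strings n. pauli_coeff n A P * pauli_string_mat P $$ (x, y))"
    using xy pauli_string_mat_carrier by (fastforce simp: mat_sum_def intro!: sum.cong)
  also have "\<dots> = (\<Sum>P\<in>pauli_strings n. \<Sum>u<2 ^ n. \<Sum>v<2 ^ n. A $$ (v, u) / 2 ^ n *
      (pauli_string_mat P $$ (u, v) * pauli_string_mat P $$ (x, y)))"
    using A pauli_string_mat_carrier
    by (intro sum.cong) (auto simp: pauli_coeff_def mat_trace_mult[where N = "2 ^ n"]
        sum_divide_distrib sum_distrib_left sum_distrib_right mult_ac)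
  also have "\<dots> = (\<Sum>u<2 ^ n. \<Sum>v<2 ^ n. A $$ (v, u) / 2 ^ n *
      (\<Sum>P\<in>pauli_strings n. pauli_string_mat P $$ (u, v) * pauli_string_mat P $$ (x, y)))"
    \<comment> \<open>The sum over strings moves inwards past \<open>u\<close> and then past
      \<open>v\<close>.\<close>
    by (subst sum.swap, intro sum.cong refl, subst sum.swap) (simp add: sum_distrib_left)
  also have "\<dots> = (\<Sum>u<2 ^ n. \<Sum>v<2 ^ n. if u = y then if v = x then A $$ (v, u) else 0 else 0)"
    using xy by (intro sum.cong refl) (simp add: pauli_string_completeness)
  also have "\<dots> = (\<Sum>u<2 ^ n. if u = y then A $$ (x, u) else 0)"
    using xy by (intro sum.cong refl) simp
  also have "\<dots> = A $$ (x, y)"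
    using xy by simp
  finally show "A $$ (x, y) = ?S $$ (x, y)" ..
qed (use A in \<open>auto simp: mat_sum_def\<close>)

lemma pauli_support_mat_diag_factors:
  assumes P: "P \<in> pauli_support n (mat_diag (2 ^ n) d)" and j: "j < n"
  shows "P ! j \<in> {PI, PZ}"
proof (rule ccontr)
  assume "P ! j \<notin> {PI, PZ}"
  then have off: "P ! j = PX \<or> P ! j = PY" by (cases "P ! j") auto
  have PS: "P \<in> pauli_strings n" using P by (simp add: pauli_support_def)
  \<comment> \<open>The factor at position \<open>j\<close> is a diagonal entry of X or Y, hence 0,
    and annihilates the whole product.\<close>
  have "pauli_string_mat P $$ (x, x) = 0" if "x < 2 ^ n" for x
  proof -
    have "qbit x j = 0 \<or> qbit x j = 1" using qbit_lt_2[of x j] by linarith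
    then have "pauli_mat (P ! j) $$ (qbit x j, qbit x j) = 0"
      using off by (auto simp: mat_of_rows_list_def)
    then show ?thesis
      using j by (auto simp: pauli_string_mat_index[OF PS that that])
  qed
  then have "mat_trace (pauli_string_mat P * mat_diag (2 ^ n) d) = 0"
    using pauli_string_mat_carrier[OF PS]
    by (subst mat_trace_mult[where N = "2 ^ n"]) (auto intro!: sum.neutral)
  then show False using P by (simp add: pauli_support_def pauli_coeff_def)
qed

text \<open>Distinct indices differ in some binary digit, and there the factor is an off-diagonal
  entry of I or Z, which is 0. Writing the string through its own diagonal makes the rules for
  \<open>mat_diag\<close> applicable.\<close>

lemma pauli_support_mat_diag:
  assumes P: "P \<in> pauli_support n (mat_diag (2 ^ n) d)"
  shows "pauli_string_mat P = mat_diag (2 ^ n) (\<lambda>x. pauli_string_mat P $$ (x, x))"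
proof (rule eq_matI)
  have PS: "P \<in> pauli_strings n" using P by (simp add: pauli_support_def)
  let ?D = "mat_diag (2 ^ n) (\<lambda>x. pauli_string_mat P $$ (x, x))"
  fix x y assume "x < dim_row ?D" "y < dim_col ?D"
  then have xy: "x < 2 ^ n" "y < 2 ^ n" by simp_all
  have "pauli_string_mat P $$ (x, y) = 0" if "x \<noteq> y"
  proof -
    obtain j where j: "j < n" and ne: "qbit x j \<noteq> qbit y j"
      using qbit_ext[OF xy] \<open>x \<noteq> y\<close> by blast
    have "qbit x j = 0 \<and> qbit y j = 1 \<or> qbit x j = 1 \<and> qbit y j = 0"
      using ne qbit_lt_2[of x j] qbit_lt_2[of y j] by linarith
    then have "pauli_mat (P ! j) $$ (qbit x j, qbit y j) = 0"
      using pauli_support_mat_diag_factors[OF P j] by (auto simp: mat_of_rows_list_def)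
    then show ?thesis using j by (auto simp: pauli_string_mat_index[OF PS xy])
  qed
  then show "pauli_string_mat P $$ (x, y) = ?D $$ (x, y)" using xy by auto
qed (use P pauli_string_mat_carrier in \<open>fastforce simp: pauli_support_def\<close>)+

theorem corollary4p1:
  fixes n :: nat and C D :: real and L :: "complex mat"
  assumes "n \<ge> 1"
    and "L = arith_diag n C D"
  shows "L = mat_sum (2 ^ n) (\<lambda>P. pauli_coeff n L P \<cdot>\<^sub>m pauli_string_mat P) (pauli_strings n) \<and>
    (\<forall>P\<in>pauli_support n L. \<forall>Q\<in>pauli_support n L.
       pauli_string_mat P * pauli_string_mat Q = pauli_string_mat Q * pauli_string_mat P) \<and>
    (\<forall>\<theta>::real. \<forall>Ps. distinct Ps \<and> set Ps = pauli_support n L \<longrightarrow>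
       mat_exp ((- \<i> * complex_of_real \<theta>) \<cdot>\<^sub>m L) =
       mat_prod_list (2 ^ n)
         (map (\<lambda>P. mat_exp ((- \<i> * complex_of_real \<theta> * pauli_coeff n L P) \<cdot>\<^sub>m pauli_string_mat P)) Ps))"
proof (intro conjI ballI allI impI)
  define d where "d = (\<lambda>x. complex_of_real (C + D * real x))"
  define s where "s = (\<lambda>P x. pauli_string_mat P $$ (x, x))"
  have L: "L = mat_diag (2 ^ n) d"
    using assms(2) by (simp only: arith_diag_eq_mat_diag d_def)
  have diag: "pauli_string_mat P = mat_diag (2 ^ n) (s P)" if "P \<in> pauli_support n L" for P
    using pauli_support_mat_diag that unfolding L s_def .
  show expansion:
    "L = mat_sum (2 ^ n) (\<lambda>P. pauli_coeff n L P \<cdot>\<^sub>m pauli_string_mat P) (pauli_strings n)"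
    by (rule pauli_expansion) (simp add: L)
  show "pauli_string_mat P * pauli_string_mat Q = pauli_string_mat Q * pauli_string_mat P"
    if "P \<in> pauli_support n L" "Q \<in> pauli_support n L" for P Q
    by (simp add: diag that mult.commute)
  fix \<theta> :: real and Ps
  assume Ps: "distinct Ps \<and> set Ps = pauli_support n L"
  let ?t = "- \<i> * complex_of_real \<theta>"
  \<comment> \<open>The Pauli expansion read at a diagonal entry, summed along \<open>Ps\<close> so
    that it matches the ordered product, whatever enumeration of the support \<open>Ps\<close>
    is.\<close>
  have entry: "d x = (\<Sum>P\<leftarrow>Ps. pauli_coeff n L P * s P x)" if x: "x < 2 ^ n" for x
  proof -
    have "d x = (\<Sum>P\<in>pauli_strings n. pauli_coeff n L P * s P x)"
    proof -
      have "d x = L $$ (x, x)" using x by (simp add: L)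
      also have "\<dots> = (\<Sum>P\<in>pauli_strings n. (pauli_coeff n L P \<cdot>\<^sub>m pauli_string_mat P) $$ (x, x))"
        using x by (subst expansion) (simp add: mat_sum_def)
      also have "\<dots> = (\<Sum>P\<in>pauli_strings n. pauli_coeff n L P * s P x)"
        using x pauli_string_mat_carrier by (fastforce simp: s_def intro!: sum.cong)
      finally show ?thesis .
    qed
    \<comment> \<open>Strings outside the support have coefficient 0.\<close>
    also have "\<dots> = (\<Sum>P\<in>pauli_support n L. pauli_coeff n L P * s P x)"
      using finite_pauli_strings by (intro sum.mono_neutral_right) (auto simp: pauli_support_def)
    finally show ?thesis using Ps by (simp add: sum_list_distinct_conv_sum_set)
  qed
  have exp_sum: "exp (\<Sum>P\<leftarrow>Qs. f P) = (\<Prod>P\<leftarrow>Qs. exp (f P))" for Qs and f :: "pauli list \<Rightarrow> complex"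
    by (induction Qs) (simp_all add: exp_add)
  have "mat_prod_list (2 ^ n)
      (map (\<lambda>P. mat_exp ((?t * pauli_coeff n L P) \<cdot>\<^sub>m pauli_string_mat P)) Ps) =
    mat_prod_list (2 ^ n)
      (map (\<lambda>P. mat_diag (2 ^ n) (\<lambda>x. exp (?t * (pauli_coeff n L P * s P x)))) Ps)"
    using Ps by (intro arg_cong[where f = "mat_prod_list (2 ^ n)"] map_cong refl)
      (simp add: diag smult_mat_diag mat_exp_mat_diag mult.assoc)
  also have "\<dots> = mat_diag (2 ^ n) (\<lambda>x. exp (?t * (\<Sum>P\<leftarrow>Ps. pauli_coeff n L P * s P x)))"
    by (simp only: mat_prod_list_mat_diag exp_sum sum_list_const_mult[symmetric])
  \<comment> \<open>\<open>entry\<close> is available only for \<open>x < 2 ^ n\<close>, so the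
    matrices are compared entrywise within that range.\<close>
  also have "\<dots> = mat_diag (2 ^ n) (\<lambda>x. exp (?t * d x))"
    by (rule eq_matI) (auto simp: entry)
  also have "\<dots> = mat_exp (?t \<cdot>\<^sub>m L)"
    by (simp add: L smult_mat_diag mat_exp_mat_diag)
  finally show "mat_exp (?t \<cdot>\<^sub>m L) = mat_prod_list (2 ^ n)
      (map (\<lambda>P. mat_exp ((?t * pauli_coeff n L P) \<cdot>\<^sub>m pauli_string_mat P)) Ps)" ..
qed

end
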